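(* In the internal logic of $\mathcal{S}$ the following holds: $\forall\,\phi:\Omega^{\mathbb{K}}.\ \big(\forall\,\kappa:\mathbb{K}.\ \triangleright^{\kappa}\phi(\kappa)\big)\Rightarrow\forall\,\kappa:\mathbb{K}.\ \phi(\kappa)$.
   Context: Let $\mathbb{F}^+$ be the category whose objects are $\bullet^n$ for $n>0$ (free category with strictly associative binary products on one object); a morphism $\bullet^n\to\bullet^m$ is equivalently a function $\{0,\dots,m-1\}\to\{0,\dots,n-1\}$. Let $\mathcal{N}=\mathrm{Hom}_{\mathbb{F}^+}(-,\bullet^1)$. For $U\in\mathbb{F}^+$ let $\mathrm{CLK}[U]=\omega^{\mathcal{N}(U)}$ ordered pointwise, with $\mathrm{CLK}[f](\partial_V)=(\kappa\mapsto\partial_V(f^*\kappa))$ for $f:V\to U$. The category $\mathbb{CLK}$ has objects $\mathbf{U}=(U,\partial_U)$, $\partial_U\in\mathrm{CLK}[U]$, and morphisms $f:(V,\partial_V)\to(U,\partial_U)$ the $\mathbb{F}^+$-maps $f:V\to U$ with $\mathrm{CLK}[f](\partial_V)\le\partial_U$. $\mathcal{S}$ is the presheaf topos on $\mathbb{CLK}$; the clock object is $\mathbb{K}(U,\partial_U)=\mathcal{N}(U)$. Write $\mathbf{U}[\kappa\mapsto n]$ for $(U,\partial_U[\kappa\mapsto n])$ and $[\kappa\mathrel{+}=1]:\mathbf{U}\to\mathbf{U}[\kappa\mapsto\partial_U(\kappa)+1]$ for the morphism whose underlying $\mathbb{F}^+$-map is the identity. For $\kappa\in\mathbb{K}(\mathbf{U})$,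 a subobject $\phi$ of $X$ and $\alpha\in X(\mathbf{U})$, the later modality is defined by its Kripke–Joyal forcing clause: $\mathbf{U}\Vdash\triangleright^{\kappa}\phi(\alpha)$ holds iff either $\partial_U(\kappa)=0$, or $\partial_U(\kappa)=n+1$ and $\mathbf{U}[\kappa\mapsto n]\Vdash\phi([\kappa\mathrel{+}=1]^*\alpha)$. All other connectives have their standard Kripke–Joyal interpretation. *)

theory Defs
  imports "HOL-Library.FuncSet"
begin

section \<open>Small categories and presheaves\<close>

record ('o, 'a) category =
  Ob :: "'o set"
  Arr :: "'a set"
  Dom :: "'a \<Rightarrow> 'o"
  Cod :: "'a \<Rightarrow> 'o"
  Ident :: "'o \<Rightarrow> 'a"
  Comp :: "'a \<Rightarrow> 'a \<Rightarrow> 'a"  \<comment> \<open>\<open>Comp C g f\<close> is \<open>g\<close> after \<open>f\<close>\<close>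

definition hom :: "('o, 'a) category \<Rightarrow> 'o \<Rightarrow> 'o \<Rightarrow> 'a set" where
  "hom C V U = {f \<in> Arr C. Dom C f = V \<and> Cod C f = U}"

definition arrows_to :: "('o, 'a) category \<Rightarrow> 'o \<Rightarrow> 'a set" where
  "arrows_to C U = {f \<in> Arr C. Cod C f = U}"

definition is_category :: "('o, 'a) category \<Rightarrow> bool" where
  "is_category C \<longleftrightarrow>
     (\<forall>f\<in>Arr C. Dom C f \<in> Ob C \<and> Cod C f \<in> Ob C) \<and>
     (\<forall>U\<in>Ob C. Ident C U \<in> hom C U U) \<and>
     (\<forall>f\<in>Arr C. \<forall>g\<in>Arr C. Dom C g = Cod C f \<longrightarrow> Comp C g f \<in> hom C (Dom C f) (Cod C g)) \<and>
     (\<forall>f\<in>Arr C. Comp C f (Ident C (Dom C f)) = f \<and> Comp C (Ident C (Cod C f)) f = f) \<and>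
     (\<forall>f\<in>Arr C. \<forall>g\<in>Arr C. \<forall>h\<in>Arr C. Dom C g = Cod C f \<longrightarrow> Dom C h = Cod C g \<longrightarrow>
        Comp C h (Comp C g f) = Comp C (Comp C h g) f)"

text \<open>
  A presheaf assigns to each object \<open>U\<close> the set \<open>El P U\<close>, and to each arrow \<open>f : V \<rightarrow> U\<close> the
  restriction map \<open>res P f\<close> from \<open>El P U\<close> to \<open>El P V\<close>.
\<close>

record ('o, 'a, 'x) presheaf =
  El :: "'o \<Rightarrow> 'x set"
  res :: "'a \<Rightarrow> 'x \<Rightarrow> 'x"

definition is_presheaf :: "('o, 'a) category \<Rightarrow> ('o, 'a, 'x) presheaf \<Rightarrow> bool" where
  "is_presheaf C P \<longleftrightarrow>
     (\<forall>f\<in>Arr C. \<forall>x\<in>El P (Cod C f). res P f x \<in> El P (Dom C f)) \<and>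
     (\<forall>U\<in>Ob C. \<forall>x\<in>El P U. res P (Ident C U) x = x) \<and>
     (\<forall>f\<in>Arr C. \<forall>g\<in>Arr C. Dom C g = Cod C f \<longrightarrow>
        (\<forall>x\<in>El P (Cod C g). res P (Comp C g f) x = res P f (res P g x)))"

definition terminal :: "('o, 'a, unit) presheaf" where
  "terminal = \<lparr>El = (\<lambda>U. UNIV), res = (\<lambda>f x. x)\<rparr>"

definition product ::
  "('o, 'a, 'x) presheaf \<Rightarrow> ('o, 'a, 'y) presheaf \<Rightarrow> ('o, 'a, 'x \<times> 'y) presheaf" where
  "product P Q = \<lparr>El = (\<lambda>U. El P U \<times> El Q U), res = (\<lambda>f (x, y). (res P f x, res Q f y))\<rparr>"

definition yoneda :: "('o, 'a) category \<Rightarrow> 'o \<Rightarrow> ('o, 'a, 'a) presheaf" where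
  "yoneda C U = \<lparr>El = (\<lambda>V. hom C V U), res = (\<lambda>f g. Comp C g f)\<rparr>"

definition nat_trans ::
  "('o, 'a) category \<Rightarrow> ('o, 'a, 'x) presheaf \<Rightarrow> ('o, 'a, 'y) presheaf \<Rightarrow> ('o \<Rightarrow> 'x \<Rightarrow> 'y) set" where
  "nat_trans C P Q =
     {\<eta> \<in> (\<Pi>\<^sub>E V\<in>Ob C. El P V \<rightarrow>\<^sub>E El Q V).
        \<forall>f\<in>Arr C. \<forall>x\<in>El P (Cod C f). \<eta> (Dom C f) (res P f x) = res Q f (\<eta> (Cod C f) x)}"

text \<open>The exponential \<open>Q\<close> to the power \<open>P\<close>.\<close>

definition exponential ::
  "('o, 'a) category \<Rightarrow> ('o, 'a, 'x) presheaf \<Rightarrow> ('o, 'a, 'y) presheaf \<Rightarrow>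
   ('o, 'a, 'o \<Rightarrow> 'a \<times> 'x \<Rightarrow> 'y) presheaf" where
  "exponential C P Q =
     \<lparr>El = (\<lambda>U. nat_trans C (product (yoneda C U) P) Q),
      res = (\<lambda>f \<theta>. \<lambda>V\<in>Ob C. \<lambda>(g, x)\<in>El (product (yoneda C (Dom C f)) P) V. \<theta> V (Comp C f g, x))\<rparr>"

definition eval_at ::
  "('o, 'a) category \<Rightarrow> 'o \<Rightarrow> ('o \<Rightarrow> 'a \<times> 'x \<Rightarrow> 'y) \<Rightarrow> 'x \<Rightarrow> 'y" where
  "eval_at C U \<theta> x = \<theta> U (Ident C U, x)"

definition sieves :: "('o, 'a) category \<Rightarrow> 'o \<Rightarrow> 'a set set" where
  "sieves C U =
     {S. S \<subseteq> arrows_to C U \<and> (\<forall>f\<in>S. \<forall>g\<in>arrows_to C (Dom C f). Comp C f g \<in> S)}"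

definition Omega :: "('o, 'a) category \<Rightarrow> ('o, 'a, 'a set) presheaf" where
  "Omega C =
     \<lparr>El = sieves C, res = (\<lambda>f S. {g \<in> arrows_to C (Dom C f). Comp C f g \<in> S})\<rparr>"


section \<open>Kripke--Joyal semantics\<close>

text \<open>
  A formula in context \<open>X\<close>, that is, a subobject of the presheaf \<open>X\<close>, is given by its forcing
  relation: \<open>\<phi> U \<alpha>\<close> stands for \<open>U \<Vdash> \<phi>(\<alpha>)\<close>, where \<open>\<alpha> \<in> El X U\<close>.
\<close>

type_synonym ('o, 'x) formula = "'o \<Rightarrow> 'x \<Rightarrow> bool"

definition subobject ::
  "('o, 'a) category \<Rightarrow> ('o, 'a, 'x) presheaf \<Rightarrow> ('o, 'x) formula \<Rightarrow> bool" where
  "subobject C X \<phi> \<longleftrightarrow>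
     (\<forall>f\<in>Arr C. \<forall>\<alpha>\<in>El X (Cod C f). \<phi> (Cod C f) \<alpha> \<longrightarrow> \<phi> (Dom C f) (res X f \<alpha>))"

text \<open>
  The subobject of \<open>X\<close> classified by \<open>\<chi>\<close>, an arrow from \<open>X\<close> to \<open>Omega C\<close>: the truth value
  \<open>true\<close> at \<open>U\<close> is the maximal sieve.
\<close>

definition classified :: "('o, 'a) category \<Rightarrow> ('o \<Rightarrow> 'x \<Rightarrow> 'a set) \<Rightarrow> ('o, 'x) formula" where
  "classified C \<chi> U \<alpha> \<longleftrightarrow> \<chi> U \<alpha> = arrows_to C U"

definition kj_imp ::
  "('o, 'a) category \<Rightarrow> ('o, 'a, 'x) presheaf \<Rightarrow>
   ('o, 'x) formula \<Rightarrow> ('o, 'x) formula \<Rightarrow> ('o, 'x) formula" where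
  "kj_imp C X \<phi> \<psi> U \<alpha> \<longleftrightarrow>
     (\<forall>f\<in>arrows_to C U. \<phi> (Dom C f) (res X f \<alpha>) \<longrightarrow> \<psi> (Dom C f) (res X f \<alpha>))"

definition kj_all ::
  "('o, 'a) category \<Rightarrow> ('o, 'a, 'x) presheaf \<Rightarrow> ('o, 'a, 'y) presheaf \<Rightarrow>
   ('o, 'x \<times> 'y) formula \<Rightarrow> ('o, 'x) formula" where
  "kj_all C X Y \<phi> U \<alpha> \<longleftrightarrow>
     (\<forall>f\<in>arrows_to C U. \<forall>\<beta>\<in>El Y (Dom C f). \<phi> (Dom C f) (res X f \<alpha>, \<beta>))"

definition holds_internally :: "('o, 'a) category \<Rightarrow> ('o, unit) formula \<Rightarrow> bool" where
  "holds_internally C \<phi> \<longleftrightarrow> (\<forall>U\<in>Ob C. \<phi> U ())"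


section \<open>The category of clock contexts\<close>

datatype ('o, 'f) arrow = Arrow (src: 'o) (und: 'f) (tgt: 'o)

text \<open>
  The object \<open>n > 0\<close> is the \<open>n\<close>-fold power of the generating object; an arrow from \<open>n\<close> to \<open>m\<close>
  is a function from \<open>{..<m}\<close> to \<open>{..<n}\<close>, so the underlying functions compose contravariantly.
\<close>

type_synonym fplus_arrow = "(nat, nat \<Rightarrow> nat) arrow"

definition FPlus :: "(nat, fplus_arrow) category" where
  "FPlus =
     \<lparr>Ob = {n. 0 < n},
      Arr = {f. 0 < src f \<and> 0 < tgt f \<and> und f \<in> {..<tgt f} \<rightarrow>\<^sub>E {..<src f}},
      Dom = src,
      Cod = tgt,
      Ident = (\<lambda>n. Arrow n (\<lambda>i\<in>{..<n}. i) n),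
      Comp = (\<lambda>g f. Arrow (src f) (compose {..<tgt g} (und f) (und g)) (tgt g))\<rparr>"

definition clock_names :: "(nat, fplus_arrow, fplus_arrow) presheaf" where
  "clock_names = yoneda FPlus 1"

type_synonym clk_obj = "nat \<times> (fplus_arrow \<Rightarrow> nat)"

type_synonym clk_arrow = "(clk_obj, fplus_arrow) arrow"

definition clk_assignments :: "nat \<Rightarrow> (fplus_arrow \<Rightarrow> nat) set" where
  "clk_assignments U = El clock_names U \<rightarrow>\<^sub>E UNIV"

definition clk_map :: "fplus_arrow \<Rightarrow> (fplus_arrow \<Rightarrow> nat) \<Rightarrow> (fplus_arrow \<Rightarrow> nat)" where
  "clk_map f d = (\<lambda>\<kappa>\<in>El clock_names (tgt f). d (res clock_names f \<kappa>))"

definition clk_le :: "nat \<Rightarrow> (fplus_arrow \<Rightarrow> nat) \<Rightarrow> (fplus_arrow \<Rightarrow> nat) \<Rightarrow> bool" where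
  "clk_le U d d' \<longleftrightarrow> (\<forall>\<kappa>\<in>El clock_names U. d \<kappa> \<le> d' \<kappa>)"

definition clk_objects :: "clk_obj set" where
  "clk_objects = {(U, d). U \<in> Ob FPlus \<and> d \<in> clk_assignments U}"

definition CLK :: "(clk_obj, clk_arrow) category" where
  "CLK =
     \<lparr>Ob = clk_objects,
      Arr = {f. src f \<in> clk_objects \<and> tgt f \<in> clk_objects \<and>
                und f \<in> hom FPlus (fst (src f)) (fst (tgt f)) \<and>
                clk_le (fst (tgt f)) (clk_map (und f) (snd (src f))) (snd (tgt f))},
      Dom = src,
      Cod = tgt,
      Ident = (\<lambda>U. Arrow U (Ident FPlus (fst U)) U),
      Comp = (\<lambda>g f. Arrow (src f) (Comp FPlus (und g) (und f)) (tgt g))\<rparr>"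

definition Clock :: "(clk_obj, clk_arrow, fplus_arrow) presheaf" where
  "Clock = \<lparr>El = (\<lambda>U. El clock_names (fst U)), res = (\<lambda>f. res clock_names (und f))\<rparr>"

definition clk_upd :: "clk_obj \<Rightarrow> fplus_arrow \<Rightarrow> nat \<Rightarrow> clk_obj" where
  "clk_upd U \<kappa> n = (fst U, (snd U)(\<kappa> := n))"

definition clk_incr :: "clk_obj \<Rightarrow> fplus_arrow \<Rightarrow> clk_arrow" where
  "clk_incr U \<kappa> = Arrow U (Ident FPlus (fst U)) (clk_upd U \<kappa> (snd U \<kappa> + 1))"

text \<open>
  The clock is given by a term in context \<open>X\<close>, with components \<open>t U\<close> from \<open>El X U\<close> to
  \<open>El Clock U\<close>. If the clock \<open>\<kappa>\<close> has value \<open>n + 1\<close> at \<open>U\<close>, then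
  \<open>clk_incr (clk_upd U \<kappa> n) \<kappa>\<close> has codomain \<open>U\<close>.
\<close>

definition later ::
  "(clk_obj, clk_arrow, 'x) presheaf \<Rightarrow> (clk_obj \<Rightarrow> 'x \<Rightarrow> fplus_arrow) \<Rightarrow>
   (clk_obj, 'x) formula \<Rightarrow> (clk_obj, 'x) formula" where
  "later X t \<phi> U \<alpha> \<longleftrightarrow>
     (let \<kappa> = t U \<alpha> in
       snd U \<kappa> = 0 \<or>
       (\<exists>n. snd U \<kappa> = n + 1 \<and>
            \<phi> (clk_upd U \<kappa> n) (res X (clk_incr (clk_upd U \<kappa> n) \<kappa>) \<alpha>)))"


section \<open>Predicates on clocks\<close>

type_synonym clk_pred = "clk_obj \<Rightarrow> clk_arrow \<times> fplus_arrow \<Rightarrow> clk_arrow set"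

definition ClockPred :: "(clk_obj, clk_arrow, clk_pred) presheaf" where
  "ClockPred = exponential CLK Clock (Omega CLK)"

text \<open>The contexts with one variable \<open>\<phi> : ClockPred\<close>, respectively \<open>\<phi> : ClockPred, \<kappa> : Clock\<close>.\<close>

definition Ctx_pred :: "(clk_obj, clk_arrow, unit \<times> clk_pred) presheaf" where
  "Ctx_pred = product terminal ClockPred"

definition Ctx_pred_clock :: "(clk_obj, clk_arrow, (unit \<times> clk_pred) \<times> fplus_arrow) presheaf" where
  "Ctx_pred_clock = product Ctx_pred Clock"

definition var_clock :: "clk_obj \<Rightarrow> (unit \<times> clk_pred) \<times> fplus_arrow \<Rightarrow> fplus_arrow" where
  "var_clock U \<alpha> = snd \<alpha>"

text \<open>The atomic formula \<open>\<phi>(\<kappa>)\<close>.\<close>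

definition pred_app :: "(clk_obj, (unit \<times> clk_pred) \<times> fplus_arrow) formula" where
  "pred_app = classified CLK (\<lambda>U ((_, \<phi>), \<kappa>). eval_at CLK U \<phi> \<kappa>)"


section \<open>The constructions are well defined\<close>

lemma is_category_FPlus: "is_category FPlus"
  unfolding is_category_def
proof (intro conjI ballI impI)
  fix f assume f: "f \<in> Arr FPlus"
  show "Comp FPlus f (Ident FPlus (Dom FPlus f)) = f"
    using f by (cases f) (auto simp: FPlus_def compose_def PiE_def Pi_def extensional_def restrict_def fun_eq_iff)
  show "Comp FPlus (Ident FPlus (Cod FPlus f)) f = f"
    using f by (cases f) (auto simp: FPlus_def compose_def PiE_def Pi_def extensional_def restrict_def fun_eq_iff)
qed (auto simp: FPlus_def hom_def compose_def PiE_def Pi_def extensional_def restrict_def fun_eq_iff)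

lemma is_presheaf_yoneda: "is_category C \<Longrightarrow> U \<in> Ob C \<Longrightarrow> is_presheaf C (yoneda C U)"
  unfolding is_category_def is_presheaf_def yoneda_def hom_def by auto

lemma is_presheaf_product:
  "is_presheaf C P \<Longrightarrow> is_presheaf C Q \<Longrightarrow> is_presheaf C (product P Q)"
  unfolding is_presheaf_def product_def by auto

lemma is_presheaf_terminal: "is_presheaf C terminal"
  unfolding is_presheaf_def terminal_def by auto

lemma is_presheaf_Omega:
  assumes "is_category C" shows "is_presheaf C (Omega C)"
proof -
  have comp: "Comp C g f \<in> Arr C" "Dom C (Comp C g f) = Dom C f" "Cod C (Comp C g f) = Cod C g"
    if "f \<in> Arr C" "g \<in> Arr C" "Dom C g = Cod C f" for f g
    using assms that unfolding is_category_def hom_def by auto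
  have assoc: "Comp C h (Comp C g f) = Comp C (Comp C h g) f"
    if "f \<in> Arr C" "g \<in> Arr C" "h \<in> Arr C" "Dom C g = Cod C f" "Dom C h = Cod C g" for f g h
    using assms that unfolding is_category_def by auto
  have idn: "Comp C (Ident C U) f = f" "Dom C (Ident C U) = U" if "U \<in> Ob C" "f \<in> arrows_to C U" for U f
    using assms that unfolding is_category_def arrows_to_def hom_def by auto
  have idd: "Dom C (Ident C U) = U" if "U \<in> Ob C" for U
    using assms that unfolding is_category_def hom_def by auto
  show ?thesis
    unfolding is_presheaf_def
  proof (intro conjI ballI impI)
    fix f S assume f: "f \<in> Arr C" and S: "S \<in> El (Omega C) (Cod C f)"
    have "Comp C f (Comp C g h) \<in> S"
      if "g \<in> Arr C" "Cod C g = Dom C f" "Comp C f g \<in> S" "h \<in> Arr C" "Cod C h = Dom C g" for g h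
      using S f that comp[of g f] assoc[of h g f] by (simp add: Omega_def sieves_def arrows_to_def)
    then show "res (Omega C) f S \<in> El (Omega C) (Dom C f)"
      using comp by (auto simp: Omega_def sieves_def arrows_to_def)
  next
    fix U S assume "U \<in> Ob C" "S \<in> El (Omega C) U"
    then show "res (Omega C) (Ident C U) S = S"
      using idn idd by (auto simp: Omega_def sieves_def)
  next
    fix f g S assume f: "f \<in> Arr C" and g: "g \<in> Arr C" "Dom C g = Cod C f"
    show "res (Omega C) (Comp C g f) S = res (Omega C) f (res (Omega C) g S)"
      using f g comp[of f g] comp[of _ f] assoc[of _ f g]
      by (auto simp: Omega_def arrows_to_def)
  qed
qed

lemma is_presheaf_clock_names: "is_presheaf FPlus clock_names"
  unfolding clock_names_def by (rule is_presheaf_yoneda[OF is_category_FPlus]) (simp add: FPlus_def)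

lemma nt_ext:
  assumes "\<eta> \<in> (\<Pi>\<^sub>E V\<in>A. P V \<rightarrow>\<^sub>E Q V)" "\<theta> \<in> (\<Pi>\<^sub>E V\<in>A. P V \<rightarrow>\<^sub>E Q V)"
    "\<And>V x. V \<in> A \<Longrightarrow> x \<in> P V \<Longrightarrow> \<eta> V x = \<theta> V x"
  shows "\<eta> = \<theta>"
proof (rule PiE_ext[OF assms(1,2)])
  fix V assume V: "V \<in> A"
  show "\<eta> V = \<theta> V"
    by (rule PiE_ext[OF PiE_mem[OF assms(1) V] PiE_mem[OF assms(2) V]]) (simp add: assms(3) V)
qed

lemma is_presheaf_exponential:
  assumes C: "is_category C" and P: "is_presheaf C P" and Q: "is_presheaf C Q"
  shows "is_presheaf C (exponential C P Q)"
proof -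
  let ?E = "exponential C P Q"
  have dom: "Dom C f \<in> Ob C" "Cod C f \<in> Ob C" if "f \<in> Arr C" for f
    using C that unfolding is_category_def by auto
  have comp: "Comp C g f \<in> hom C (Dom C f) (Cod C g)"
    if "f \<in> Arr C" "g \<in> Arr C" "Dom C g = Cod C f" for f g
    using C that unfolding is_category_def by auto
  have assoc: "Comp C h (Comp C g f) = Comp C (Comp C h g) f"
    if "f \<in> Arr C" "g \<in> Arr C" "h \<in> Arr C" "Dom C g = Cod C f" "Dom C h = Cod C g" for f g h
    using C that unfolding is_category_def by auto
  have resP: "res P f x \<in> El P (Dom C f)" if "f \<in> Arr C" "x \<in> El P (Cod C f)" for f x
    using P that unfolding is_presheaf_def by auto
  have cl: "res ?E f \<theta> \<in> El ?E (Dom C f)" if f: "f \<in> Arr C" and t: "\<theta> \<in> El ?E (Cod C f)" for f \<theta>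
  proof -
    have t1: "\<theta> V (Comp C f g, x) \<in> El Q V" if "V \<in> Ob C" "g \<in> hom C V (Dom C f)" "x \<in> El P V" for V g x
    proof -
      have "Comp C f g \<in> hom C V (Cod C f)" using comp[of g f] that f by (auto simp: hom_def)
      then show ?thesis using t that
        by (auto simp: exponential_def nat_trans_def product_def yoneda_def PiE_def Pi_def)
    qed
    have t2: "\<theta> (Dom C h) (Comp C (Comp C f g) h, res P h x) = res Q h (\<theta> (Cod C h) (Comp C f g, x))"
      if "h \<in> Arr C" "g \<in> hom C (Cod C h) (Dom C f)" "x \<in> El P (Cod C h)" for h g x
    proof -
      have "Comp C f g \<in> hom C (Cod C h) (Cod C f)" using comp[of g f] that f by (auto simp: hom_def)
      then show ?thesis using t that
        by (auto simp: exponential_def nat_trans_def product_def yoneda_def)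
    qed
    show ?thesis
      using t1 t2 dom comp assoc resP f
      by (auto simp: exponential_def nat_trans_def product_def yoneda_def hom_def split: if_splits)
  qed
  have idn: "res ?E (Ident C U) \<theta> = \<theta>" if U: "U \<in> Ob C" and t: "\<theta> \<in> El ?E U" for U \<theta>
  proof (rule nt_ext[where A = "Ob C" and P = "El (product (yoneda C U) P)" and Q = "El Q"])
    have "res ?E (Ident C U) \<theta> \<in> El ?E U"
      using cl[of "Ident C U" \<theta>] U t C by (auto simp: is_category_def hom_def)
    then show "res ?E (Ident C U) \<theta> \<in> (\<Pi>\<^sub>E V\<in>Ob C. El (product (yoneda C U) P) V \<rightarrow>\<^sub>E El Q V)"
      by (simp add: exponential_def nat_trans_def)
    show "\<theta> \<in> (\<Pi>\<^sub>E V\<in>Ob C. El (product (yoneda C U) P) V \<rightarrow>\<^sub>E El Q V)"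
      using t by (simp add: exponential_def nat_trans_def)
  qed (use U C in \<open>auto simp: exponential_def product_def yoneda_def hom_def is_category_def\<close>)
  have cmp: "res ?E (Comp C g f) \<theta> = res ?E f (res ?E g \<theta>)"
    if fg: "f \<in> Arr C" "g \<in> Arr C" "Dom C g = Cod C f" and t: "\<theta> \<in> El ?E (Cod C g)" for f g \<theta>
  proof (rule nt_ext[where A = "Ob C" and P = "El (product (yoneda C (Dom C f)) P)" and Q = "El Q"])
    show "res ?E (Comp C g f) \<theta> \<in> (\<Pi>\<^sub>E V\<in>Ob C. El (product (yoneda C (Dom C f)) P) V \<rightarrow>\<^sub>E El Q V)"
      using cl[of "Comp C g f" \<theta>] comp[OF fg] t
      by (auto simp: exponential_def nat_trans_def hom_def)
    show "res ?E f (res ?E g \<theta>) \<in> (\<Pi>\<^sub>E V\<in>Ob C. El (product (yoneda C (Dom C f)) P) V \<rightarrow>\<^sub>E El Q V)"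
      using cl[of f "res ?E g \<theta>"] cl[of g \<theta>] fg t
      by (auto simp: exponential_def nat_trans_def hom_def)
  qed (use fg comp assoc in \<open>auto simp: exponential_def product_def yoneda_def hom_def\<close>)
  show ?thesis unfolding is_presheaf_def using cl idn cmp by auto
qed

lemma clk_map_Ident:
  assumes "d \<in> clk_assignments U" "U \<in> Ob FPlus"
  shows "clk_map (Ident FPlus U) d = d"
proof -
  have "res clock_names (Ident FPlus U) \<kappa> = \<kappa>" if "\<kappa> \<in> El clock_names U" for \<kappa>
    using is_presheaf_clock_names assms(2) that by (auto simp: is_presheaf_def)
  then have "clk_map (Ident FPlus U) d = restrict d (El clock_names U)"
    by (auto simp: clk_map_def FPlus_def restrict_def fun_eq_iff)
  then show ?thesis using assms by (simp add: clk_assignments_def PiE_restrict)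
qed

lemma is_category_CLK: "is_category CLK"
  unfolding is_category_def
proof (intro conjI ballI impI)
  have F: "is_category FPlus" by (rule is_category_FPlus)
  {
    fix f assume f: "f \<in> Arr CLK"
    show "Dom CLK f \<in> Ob CLK" "Cod CLK f \<in> Ob CLK" using f by (auto simp: CLK_def)
    have u: "und f \<in> Arr FPlus" "Dom FPlus (und f) = fst (src f)" "Cod FPlus (und f) = fst (tgt f)"
      using f by (auto simp: CLK_def hom_def)
    show "Comp CLK f (Ident CLK (Dom CLK f)) = f" "Comp CLK (Ident CLK (Cod CLK f)) f = f"
      using F u by (cases f; force simp: CLK_def is_category_def)+
  next
    fix U assume "U \<in> Ob CLK"
    then show "Ident CLK U \<in> hom CLK U U"
      using F by (auto simp: CLK_def clk_objects_def hom_def is_category_def clk_map_Ident clk_le_def)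
  next
    fix f g assume f: "f \<in> Arr CLK" and g: "g \<in> Arr CLK" and fg: "Dom CLK g = Cod CLK f"
    have u: "und f \<in> Arr FPlus" "Dom FPlus (und f) = fst (src f)" "Cod FPlus (und f) = fst (tgt f)"
      "und g \<in> Arr FPlus" "Dom FPlus (und g) = fst (src g)" "Cod FPlus (und g) = fst (tgt g)"
      "src g = tgt f"
      using f g fg by (auto simp: CLK_def hom_def)
    have t: "tgt h = Cod FPlus h" for h by (simp add: FPlus_def)
    have c: "Comp FPlus (und g) (und f) \<in> hom FPlus (fst (src f)) (fst (tgt g))"
      using F u unfolding is_category_def by metis
    have "clk_le (fst (tgt g)) (clk_map (Comp FPlus (und g) (und f)) (snd (src f))) (snd (tgt g))"
      unfolding clk_le_def
    proof
      fix \<kappa> assume k: "\<kappa> \<in> El clock_names (fst (tgt g))"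
      have k': "res clock_names (und g) \<kappa> \<in> El clock_names (fst (tgt f))"
        "res clock_names (Comp FPlus (und g) (und f)) \<kappa> = res clock_names (und f) (res clock_names (und g) \<kappa>)"
        using is_presheaf_clock_names k u unfolding is_presheaf_def by metis+
      have "clk_map (Comp FPlus (und g) (und f)) (snd (src f)) \<kappa>
          = snd (src f) (res clock_names (und f) (res clock_names (und g) \<kappa>))"
        using c k k' by (simp add: clk_map_def t hom_def)
      also have "\<dots> \<le> snd (tgt f) (res clock_names (und g) \<kappa>)"
        using f k' u by (auto simp: CLK_def clk_le_def clk_map_def t)
      also have "\<dots> \<le> snd (tgt g) \<kappa>"
        using g k u by (auto simp: CLK_def clk_le_def clk_map_def t)
      finally show "clk_map (Comp FPlus (und g) (und f)) (snd (src f)) \<kappa> \<le> snd (tgt g) \<kappa>" .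
    qed
    then show "Comp CLK g f \<in> hom CLK (Dom CLK f) (Cod CLK g)"
      using c f g by (simp add: CLK_def hom_def)
  }
  fix f g h assume f: "f \<in> Arr CLK" and g: "g \<in> Arr CLK" and h: "h \<in> Arr CLK"
    and "Dom CLK g = Cod CLK f" "Dom CLK h = Cod CLK g"
  then show "Comp CLK h (Comp CLK g f) = Comp CLK (Comp CLK h g) f"
    using F by (simp add: CLK_def hom_def is_category_def)
qed

lemma is_presheaf_Clock: "is_presheaf CLK Clock"
  using is_presheaf_clock_names unfolding is_presheaf_def Clock_def CLK_def hom_def clk_objects_def
  by auto

lemma is_presheaf_ClockPred: "is_presheaf CLK ClockPred"
  unfolding ClockPred_def
  by (intro is_presheaf_exponential is_presheaf_Omega is_category_CLK is_presheaf_Clock)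


lemma subobject_classified:
  assumes "\<forall>f\<in>Arr C. \<forall>\<alpha>\<in>El X (Cod C f). \<chi> (Dom C f) (res X f \<alpha>) = res (Omega C) f (\<chi> (Cod C f) \<alpha>)"
    and "is_category C"
  shows "subobject C X (classified C \<chi>)"
  unfolding subobject_def
proof (intro ballI impI)
  fix f \<alpha> assume f: "f \<in> Arr C" "\<alpha> \<in> El X (Cod C f)" and c: "classified C \<chi> (Cod C f) \<alpha>"
  have "Comp C f g \<in> arrows_to C (Cod C f)" if "g \<in> arrows_to C (Dom C f)" for g
    using assms(2) that f(1) unfolding is_category_def arrows_to_def hom_def by simp
  then have "res (Omega C) f (arrows_to C (Cod C f)) = arrows_to C (Dom C f)"
    by (auto simp: Omega_def)
  then show "classified C \<chi> (Dom C f) (res X f \<alpha>)"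
    using assms(1) f c by (simp add: classified_def)
qed

lemma subobject_pred_app: "subobject CLK Ctx_pred_clock pred_app"
  unfolding pred_app_def
proof (rule subobject_classified[OF _ is_category_CLK], intro ballI)
  fix f \<alpha> assume f: "f \<in> Arr CLK" and a: "\<alpha> \<in> El Ctx_pred_clock (Cod CLK f)"
  obtain \<phi> \<kappa> where [simp]: "\<alpha> = (((), \<phi>), \<kappa>)" by (metis surj_pair unit.exhaust)
  have p: "\<phi> \<in> El ClockPred (Cod CLK f)" and k: "\<kappa> \<in> El Clock (Cod CLK f)"
    using a by (auto simp: Ctx_pred_clock_def Ctx_pred_def product_def)
  have C: "Dom CLK f \<in> Ob CLK" "Cod CLK f \<in> Ob CLK" "Ident CLK (Dom CLK f) \<in> hom CLK (Dom CLK f) (Dom CLK f)"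
    "Ident CLK (Cod CLK f) \<in> hom CLK (Cod CLK f) (Cod CLK f)"
    "Comp CLK f (Ident CLK (Dom CLK f)) = f" "Comp CLK (Ident CLK (Cod CLK f)) f = f"
    using is_category_CLK f unfolding is_category_def by auto
  have rk: "res Clock f \<kappa> \<in> El Clock (Dom CLK f)"
    using is_presheaf_Clock f k unfolding is_presheaf_def by auto
  have "\<phi> (Dom CLK f) (Comp CLK (Ident CLK (Cod CLK f)) f, res Clock f \<kappa>)
     = res (Omega CLK) f (\<phi> (Cod CLK f) (Ident CLK (Cod CLK f), \<kappa>))"
  proof -
    have "\<forall>fa\<in>Arr CLK. \<forall>x\<in>hom CLK (Cod CLK fa) (Cod CLK f). \<forall>y\<in>El Clock (Cod CLK fa).
      \<phi> (Dom CLK fa) (Comp CLK x fa, res Clock fa y) = res (Omega CLK) fa (\<phi> (Cod CLK fa) (x, y))"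
      using p by (simp add: ClockPred_def exponential_def nat_trans_def product_def yoneda_def)
    then show ?thesis using k C(4) f by blast
  qed
  then show "(case res Ctx_pred_clock f \<alpha> of (x, \<kappa>) \<Rightarrow> (case x of (_, \<phi>) \<Rightarrow> eval_at CLK (Dom CLK f) \<phi>) \<kappa>) =
           res (Omega CLK) f (case \<alpha> of (x, \<kappa>) \<Rightarrow> (case x of (_, \<phi>) \<Rightarrow> eval_at CLK (Cod CLK f) \<phi>) \<kappa>)"
    using C rk by (simp add: Ctx_pred_clock_def Ctx_pred_def product_def eval_at_def ClockPred_def exponential_def yoneda_def)
qed

lemma subobject_later:
  assumes X: "is_presheaf CLK X" and t: "t \<in> nat_trans CLK X Clock" and s: "subobject CLK X \<phi>"
  shows "subobject CLK X (later X t \<phi>)"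
  unfolding subobject_def
proof (intro ballI impI)
  fix f \<alpha> assume f: "f \<in> Arr CLK" and a: "\<alpha> \<in> El X (Cod CLK f)" and l: "later X t \<phi> (Cod CLK f) \<alpha>"
  define U V \<kappa> \<kappa>' where "U = tgt f" and "V = src f" and "\<kappa> = t U \<alpha>" and "\<kappa>' = t V (res X f \<alpha>)"
  note d = U_def V_def
  have DC: "Dom CLK = src" "Cod CLK = tgt" "Dom FPlus = src" "Cod FPlus = tgt" by (auto simp: CLK_def FPlus_def)
  have obs: "U \<in> clk_objects" "V \<in> clk_objects" "und f \<in> hom FPlus (fst V) (fst U)"
    using f by (auto simp: CLK_def d)
  have le: "snd V (res clock_names (und f) \<mu>) \<le> snd U \<mu>" if "\<mu> \<in> El clock_names (fst U)" for \<mu>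
    using f that obs by (auto simp: CLK_def clk_le_def clk_map_def hom_def d DC)
  have kk: "\<kappa> \<in> El clock_names (fst U)"
  proof -
    have "t U \<in> El X U \<rightarrow>\<^sub>E El Clock U" using t obs by (auto simp: nat_trans_def CLK_def)
    then show ?thesis using a by (auto simp: \<kappa>_def Clock_def DC d)
  qed
  have kk': "\<kappa>' = res clock_names (und f) \<kappa>"
    using t a f by (auto simp: nat_trans_def \<kappa>_def \<kappa>'_def Clock_def DC d)
  have kV: "\<kappa>' \<in> El clock_names (fst V)"
    using is_presheaf_clock_names kk obs unfolding kk' is_presheaf_def by (auto simp: hom_def)
  show "later X t \<phi> (Dom CLK f) (res X f \<alpha>)"
  proof (cases "snd V \<kappa>'")
    case 0
    then show ?thesis by (simp add: later_def DC \<kappa>'_def V_def)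
  next
    case (Suc n')
    with le[OF kk] kk' obtain n where n: "snd U \<kappa> = Suc n" "n' \<le> n"
      by (metis Suc_le_D Suc_le_mono)
    let ?V = "clk_upd V \<kappa>' n'" and ?U = "clk_upd U \<kappa> n"
    let ?iV = "clk_incr ?V \<kappa>'" and ?iU = "clk_incr ?U \<kappa>"
    let ?f = "Arrow ?V (und f) ?U"
    have upd: "clk_upd W \<mu> m \<in> clk_objects" if "W \<in> clk_objects" "\<mu> \<in> El clock_names (fst W)" for W \<mu> m
      using that by (auto simp: clk_objects_def clk_upd_def clk_assignments_def PiE_def extensional_def)
    have inc: "clk_incr (clk_upd W \<mu> m) \<mu> \<in> hom CLK (clk_upd W \<mu> m) W"
      if "W \<in> clk_objects" "\<mu> \<in> El clock_names (fst W)" "snd W \<mu> = Suc m" for W \<mu> m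
    proof -
      have e: "clk_upd (clk_upd W \<mu> m) \<mu> (Suc m) = W"
        using that(3) by (cases W) (auto simp: clk_upd_def)
      have "fst W \<in> Ob FPlus" using that by (auto simp: clk_objects_def)
      moreover have "snd (clk_upd W \<mu> m) \<in> clk_assignments (fst W)"
        using upd[OF that(1,2)] by (auto simp: clk_objects_def clk_upd_def)
      ultimately show ?thesis
        using that e upd[OF that(1,2)] is_category_FPlus clk_map_Ident
        by (auto simp: hom_def CLK_def clk_incr_def clk_upd_def clk_le_def is_category_def)
    qed
    have iV: "?iV \<in> hom CLK ?V V" and iU: "?iU \<in> hom CLK ?U U"
      using inc obs kV kk n Suc by auto
    have f': "?f \<in> hom CLK ?V ?U"
      using upd[OF obs(1) kk] upd[OF obs(2) kV] obs le n Suc kk'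
      by (force simp: hom_def CLK_def clk_le_def clk_map_def clk_upd_def DC)
    have sq: "Comp CLK f ?iV = Comp CLK ?iU ?f"
      using obs is_category_FPlus
      by (auto simp: CLK_def clk_incr_def clk_upd_def hom_def is_category_def d DC)
         (use n(1) in \<open>cases U; auto simp: U_def[symmetric]\<close>)
    have "\<phi> ?U (res X ?iU \<alpha>)" using l n by (auto simp: later_def \<kappa>_def DC U_def Let_def)
    then have "\<phi> ?V (res X ?f (res X ?iU \<alpha>))"
    proof -
      have "res X ?iU \<alpha> \<in> El X ?U" using X iU a unfolding is_presheaf_def hom_def by (force simp: U_def DC)
      moreover assume "\<phi> ?U (res X ?iU \<alpha>)"
      ultimately show ?thesis using s f' unfolding subobject_def hom_def by (force simp: DC)
    qed
    also have "res X ?f (res X ?iU \<alpha>) = res X (Comp CLK ?iU ?f) \<alpha>"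
      using X f' iU a unfolding is_presheaf_def hom_def by (auto simp: U_def DC)
    also have "\<dots> = res X ?iV (res X f \<alpha>)"
      using X f iV a unfolding sq[symmetric] is_presheaf_def hom_def by (auto simp: V_def DC)
    finally show ?thesis using Suc by (auto simp: later_def DC V_def \<kappa>'_def Let_def)
  qed
qed

end

theory Submission
  imports Defs
begin

text \<open>
  To obtain \<open>\<phi>(\<kappa>)\<close> at \<open>V\<close>, adjoin a fresh clock \<open>\<kappa>'\<close> with value \<open>\<partial>\<^sub>V(\<kappa>) + 1\<close>. The hypothesis for
  \<open>\<kappa>'\<close> gives \<open>\<phi>(\<kappa>')\<close> once \<open>\<kappa>'\<close> has been decremented to \<open>\<partial>\<^sub>V(\<kappa>)\<close>. At that value, identifying
  \<open>\<kappa>'\<close> with \<open>\<kappa>\<close> is a map of clock contexts, and restricting along it gives \<open>\<phi>(\<kappa>)\<close> at \<open>V\<close>,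
  because it is a section of the projection that forgets \<open>\<kappa>'\<close>. No induction on time is involved.
\<close>

text \<open>The \<open>i\<close>-th product projection: an arrow from \<open>n\<close> to
  \<open>1\<close> is a function on a single point, so a clock at \<open>n\<close> amounts to a
  number below \<open>n\<close>.\<close>

definition clock_name :: "nat \<Rightarrow> nat \<Rightarrow> fplus_arrow" where
  "clock_name n i = Arrow n (\<lambda>j\<in>{..<1}. i) 1"

lemma El_clock_names: "El clock_names n = clock_name n ` {..<n}"
proof (intro equalityI subsetI)
  fix \<kappa> assume "\<kappa> \<in> El clock_names n"
  then have k: "\<kappa> \<in> Arr FPlus" and st: "src \<kappa> = n" "tgt \<kappa> = 1"
    by (simp_all add: clock_names_def yoneda_def hom_def) (simp_all add: FPlus_def)
  have "und \<kappa> \<in> {..<tgt \<kappa>} \<rightarrow>\<^sub>E {..<src \<kappa>}" using k by (simp add: FPlus_def)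
  then have u: "und \<kappa> \<in> {..<1} \<rightarrow>\<^sub>E {..<n}" by (simp only: st)
  \<comment> \<open>For \<open>j > 0\<close> both sides are \<open>undefined\<close>, the left one
    by extensionality of \<open>und \<kappa>\<close>.\<close>
  have "und \<kappa> j = (\<lambda>j\<in>{..<1}. und \<kappa> 0) j" for j
    using PiE_arb[OF u, of j] by (cases j) auto
  then have "und \<kappa> = (\<lambda>j\<in>{..<1}. und \<kappa> 0)" ..
  then have "\<kappa> = clock_name n (und \<kappa> 0)"
    unfolding clock_name_def using st by (metis arrow.collapse)
  moreover have "und \<kappa> 0 < n" using PiE_mem[OF u, of 0] by simp
  ultimately show "\<kappa> \<in> clock_name n ` {..<n}" by blast
next
  fix \<kappa> assume "\<kappa> \<in> clock_name n ` {..<n}"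
  then obtain i where "i < n" "\<kappa> = clock_name n i" by blast
  then show "\<kappa> \<in> El clock_names n"
    by (simp add: clock_names_def yoneda_def hom_def FPlus_def clock_name_def)
qed

lemma res_clock_name:
  "res clock_names (Arrow n h m) (clock_name m i) = clock_name n (h i)"
  by (auto simp: clock_names_def yoneda_def FPlus_def clock_name_def compose_def fun_eq_iff)

lemma res_Clock_name:
  "res Clock (Arrow V (Arrow n h m) W) (clock_name m i) = clock_name n (h i)"
  by (simp add: Clock_def res_clock_name)

text \<open>The fresh clock takes the last number \<open>fst V\<close>, so that the old clocks keep
  theirs; \<open>und \<kappa> 0\<close> recovers the number of \<kappa>.\<close>

definition add_clock :: "clk_obj \<Rightarrow> nat \<Rightarrow> clk_obj" where
  "add_clock V m =
     (Suc (fst V),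
      \<lambda>\<kappa>\<in>El clock_names (Suc (fst V)).
        if und \<kappa> 0 = fst V then m else snd V (clock_name (fst V) (und \<kappa> 0)))"

abbreviation new_clock :: "clk_obj \<Rightarrow> fplus_arrow" where
  "new_clock V \<equiv> clock_name (Suc (fst V)) (fst V)"

definition forget_clock :: "clk_obj \<Rightarrow> nat \<Rightarrow> clk_arrow" where
  "forget_clock V m =
     Arrow (add_clock V m) (Arrow (Suc (fst V)) (\<lambda>i\<in>{..<fst V}. i) (fst V)) V"

text \<open>The fresh clock needs at least the value of clock \<open>i\<close> for this to be an
  arrow of \<open>CLK\<close>; it gets exactly that value.\<close>

definition identify_clock :: "clk_obj \<Rightarrow> nat \<Rightarrow> clk_arrow" where
  "identify_clock V i =
     Arrow V
       (Arrow (fst V) (\<lambda>j\<in>{..<Suc (fst V)}. if j = fst V then i else j) (Suc (fst V)))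
       (add_clock V (snd V (clock_name (fst V) i)))"

lemma fst_add_clock: "fst (add_clock V m) = Suc (fst V)"
  by (simp add: add_clock_def)

lemma snd_add_clock:
  assumes "i < Suc (fst V)"
  shows "snd (add_clock V m) (clock_name (Suc (fst V)) i) =
    (if i = fst V then m else snd V (clock_name (fst V) i))"
  using assms by (auto simp: add_clock_def El_clock_names) (auto simp: clock_name_def)

lemma add_clock_in_objects: "add_clock V m \<in> clk_objects"
  by (auto simp: clk_objects_def add_clock_def FPlus_def clk_assignments_def)

lemma new_clock_in_names: "new_clock V \<in> El clock_names (Suc (fst V))"
  by (auto simp: El_clock_names)

text \<open>Only the fresh clock has number \<open>fst V\<close>, so the update touches nothing
  else. Hence the decrement in \<open>later\<close> leads again to an object of the form
  \<open>add_clock V n\<close>.\<close>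

lemma clk_upd_add_clock: "clk_upd (add_clock V m) (new_clock V) n = add_clock V n"
proof -
  have "und \<kappa> 0 \<noteq> fst V" if "\<kappa> \<in> El clock_names (Suc (fst V))" "\<kappa> \<noteq> new_clock V" for \<kappa>
    using that by (auto simp: El_clock_names clock_name_def)
  moreover have "und (new_clock V) 0 = fst V"
    by (simp add: clock_name_def)
  ultimately show ?thesis
    using new_clock_in_names[of V] by (auto simp: clk_upd_def add_clock_def fun_eq_iff)
qed

text \<open>Turns the order condition on arrows of \<open>CLK\<close> into one inequality for each
  clock number. For the three arrows built below it compares equal values, or \<open>n\<close> with
  \<open>Suc n\<close>.\<close>

lemma clk_arrowI:
  assumes "V \<in> clk_objects" "W \<in> clk_objects" "h \<in> {..<fst W} \<rightarrow>\<^sub>E {..<fst V}"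
    and "\<And>i. i < fst W \<Longrightarrow> snd V (clock_name (fst V) (h i)) \<le> snd W (clock_name (fst W) i)"
  shows "Arrow V (Arrow (fst V) h (fst W)) W \<in> hom CLK V W"
proof -
  have pos: "0 < fst V" "0 < fst W" using assms(1,2) by (auto simp: clk_objects_def FPlus_def)
  let ?h = "Arrow (fst V) h (fst W)"
  have "?h \<in> hom FPlus (fst V) (fst W)"
    using pos assms(3) by (simp add: hom_def FPlus_def)
  moreover have "clk_le (fst W) (clk_map ?h (snd V)) (snd W)"
    unfolding clk_le_def
  proof
    fix \<kappa> assume k: "\<kappa> \<in> El clock_names (fst W)"
    then obtain i where "i < fst W" "\<kappa> = clock_name (fst W) i"
      by (auto simp: El_clock_names)
    then show "clk_map ?h (snd V) \<kappa> \<le> snd W \<kappa>"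
      using k assms(4) by (simp add: clk_map_def res_clock_name)
  qed
  ultimately show ?thesis
    using assms(1,2) by (simp add: hom_def CLK_def)
qed

lemma forget_clock_in_hom:
  assumes "V \<in> clk_objects"
  shows "forget_clock V m \<in> hom CLK (add_clock V m) V"
proof -
  have "Arrow (add_clock V m) (Arrow (fst (add_clock V m)) (\<lambda>i\<in>{..<fst V}. i) (fst V)) V
      \<in> hom CLK (add_clock V m) V"
    by (rule clk_arrowI)
      (use assms in \<open>auto simp: add_clock_in_objects fst_add_clock snd_add_clock\<close>)
  then show ?thesis by (simp add: forget_clock_def fst_add_clock)
qed

lemma identify_clock_in_hom:
  assumes "V \<in> clk_objects" "i < fst V"
  shows "identify_clock V i \<in> hom CLK V (add_clock V (snd V (clock_name (fst V) i)))"
proof -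
  let ?W = "add_clock V (snd V (clock_name (fst V) i))"
  have "Arrow V
      (Arrow (fst V) (\<lambda>j\<in>{..<Suc (fst V)}. if j = fst V then i else j) (fst ?W)) ?W \<in> hom CLK V ?W"
    by (rule clk_arrowI)
      (use assms in \<open>auto simp: add_clock_in_objects fst_add_clock snd_add_clock\<close>)
  then show ?thesis by (simp add: identify_clock_def fst_add_clock)
qed

lemma clk_incr_new_clock:
  "clk_incr (add_clock V n) (new_clock V) =
    Arrow (add_clock V n)
      (Arrow (Suc (fst V)) (\<lambda>i\<in>{..<Suc (fst V)}. i) (Suc (fst V))) (add_clock V (Suc n))"
  by (simp add: clk_incr_def clk_upd_add_clock fst_add_clock snd_add_clock FPlus_def)

lemma clk_incr_new_clock_in_hom:
  "clk_incr (add_clock V n) (new_clock V) \<in> hom CLK (add_clock V n) (add_clock V (Suc n))"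
proof -
  have "Arrow (add_clock V n)
      (Arrow (fst (add_clock V n)) (\<lambda>i\<in>{..<Suc (fst V)}. i) (fst (add_clock V (Suc n))))
      (add_clock V (Suc n)) \<in> hom CLK (add_clock V n) (add_clock V (Suc n))"
    by (rule clk_arrowI) (auto simp: add_clock_in_objects fst_add_clock snd_add_clock)
  then show ?thesis by (simp add: clk_incr_new_clock fst_add_clock)
qed

text \<open>Underlying functions compose in reverse: inclusion, identity, collapse. The inclusion
  misses \<open>fst V\<close>, the only number that the collapse moves.\<close>

lemma forget_incr_identify:
  "Comp CLK (forget_clock V (Suc n))
    (Comp CLK (clk_incr (add_clock V n) (new_clock V)) (identify_clock V i)) = Ident CLK V"
  by (auto simp: CLK_def FPlus_def clk_incr_new_clock forget_clock_def identify_clock_def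
      compose_def fun_eq_iff)

text \<open>The argument uses only that \<phi> is stable under restriction, so it works over any
  context \<open>X\<close> and not just for a predicate variable.\<close>

lemma kj_all_if_kj_all_later:
  assumes X: "is_presheaf CLK X" and s: "subobject CLK (product X Clock) \<phi>"
    and a: "\<alpha> \<in> El X U"
    and hyp: "kj_all CLK X Clock (later (product X Clock) (\<lambda>U. snd) \<phi>) U \<alpha>"
  shows "kj_all CLK X Clock \<phi> U \<alpha>"
  unfolding kj_all_def
proof (intro ballI)
  fix f \<kappa> assume f: "f \<in> arrows_to CLK U" and k: "\<kappa> \<in> El Clock (Dom CLK f)"
  define V where "V = Dom CLK f"
  have V: "V \<in> clk_objects" using f by (auto simp: V_def arrows_to_def CLK_def)
  obtain i where i: "i < fst V" and \<kappa>: "\<kappa> = clock_name (fst V) i"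
    using k by (auto simp: V_def Clock_def El_clock_names)
  \<comment> \<open>The fresh clock starts at \<open>Suc n\<close>: after the one decrement that
    \<open>later\<close> allows, it has value \<open>n\<close>, as the codomain of \<open>?s\<close>
    requires.\<close>
  define n where "n = snd V \<kappa>"
  let ?p = "forget_clock V (Suc n)" and ?c = "clk_incr (add_clock V n) (new_clock V)"
    and ?s = "identify_clock V i"
  have comp: "Comp CLK h g \<in> hom CLK A C" if "g \<in> hom CLK A B" "h \<in> hom CLK B C" for g h A B C
    using is_category_CLK that unfolding is_category_def hom_def by auto
  have resX: "res X g x \<in> El X A" if "g \<in> hom CLK A B" "x \<in> El X B" for g x A B
    using X that unfolding is_presheaf_def hom_def by auto
  have res_comp: "res X g (res X h x) = res X (Comp CLK h g) x"
    if "g \<in> hom CLK A B" "h \<in> hom CLK B C" "x \<in> El X C" for g h x A B C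
    using X that unfolding is_presheaf_def hom_def by auto
  have fh: "f \<in> hom CLK V U" using f by (auto simp: V_def hom_def arrows_to_def)
  note ph = forget_clock_in_hom[OF V, of "Suc n"]
  note ch = clk_incr_new_clock_in_hom[of V n]
  have sh: "?s \<in> hom CLK V (add_clock V n)"
    using identify_clock_in_hom[OF V i] by (simp add: n_def \<kappa>)
  have fp: "Comp CLK f ?p \<in> hom CLK (add_clock V (Suc n)) U" by (rule comp[OF ph fh])
  let ?\<beta> = "res X ?p (res X f \<alpha>)"
  \<comment> \<open>The hypothesis is used at the stage \<open>Comp CLK f ?p\<close>, for the fresh
    clock.\<close>
  have "later (product X Clock) (\<lambda>U. snd) \<phi> (add_clock V (Suc n)) (?\<beta>, new_clock V)"
    using hyp fp new_clock_in_names[of V] unfolding kj_all_def res_comp[OF ph fh a]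
    by (auto simp: arrows_to_def hom_def Clock_def fst_add_clock)
  \<comment> \<open>The fresh clock has value \<open>Suc n\<close>, which excludes the zero case of
    \<open>later\<close>.\<close>
  then have "\<phi> (add_clock V n) (res (product X Clock) ?c (?\<beta>, new_clock V))"
    by (simp add: later_def Let_def snd_add_clock clk_upd_add_clock)
  moreover have "res Clock ?c (new_clock V) = new_clock V"
    by (simp add: clk_incr_new_clock res_Clock_name)
  ultimately have "\<phi> (add_clock V n) (res X ?c ?\<beta>, new_clock V)"
    by (simp add: product_def)
  moreover have "(res X ?c ?\<beta>, new_clock V) \<in> El (product X Clock) (add_clock V n)"
    using resX[OF ch resX[OF ph resX[OF fh a]]] new_clock_in_names[of V]
    by (simp add: product_def Clock_def fst_add_clock)
  \<comment> \<open>Stability of \<phi> along \<open>?s\<close> returns to \<open>V\<close>; the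
    next two facts show that the restricted pair is the required one.\<close>
  ultimately have "\<phi> V (res (product X Clock) ?s (res X ?c ?\<beta>, new_clock V))"
    using s sh unfolding subobject_def hom_def by auto
  moreover have "res Clock ?s (new_clock V) = \<kappa>"
    by (simp add: identify_clock_def res_Clock_name \<kappa>)
  moreover have "res X ?s (res X ?c ?\<beta>) = res X f \<alpha>"
  proof -
    have "res X ?s (res X ?c ?\<beta>) = res X (Comp CLK ?p (Comp CLK ?c ?s)) (res X f \<alpha>)"
      using res_comp[OF sh ch resX[OF ph resX[OF fh a]]]
        res_comp[OF comp[OF sh ch] ph resX[OF fh a]] by simp
    also have "\<dots> = res X (Ident CLK V) (res X f \<alpha>)"
      by (simp only: forget_incr_identify)
    also have "\<dots> = res X f \<alpha>"
      using X resX[OF fh a] V by (simp add: is_presheaf_def CLK_def)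
    finally show ?thesis .
  qed
  ultimately show "\<phi> (Dom CLK f) (res X f \<alpha>, \<kappa>)"
    by (simp add: product_def V_def)
qed

theorem mainTheorem3:
  "holds_internally CLK
     (kj_all CLK terminal ClockPred
       (kj_imp CLK Ctx_pred
         (kj_all CLK Ctx_pred Clock (later Ctx_pred_clock var_clock pred_app))
         (kj_all CLK Ctx_pred Clock pred_app)))"
proof -
  have X: "is_presheaf CLK Ctx_pred"
    unfolding Ctx_pred_def
    by (intro is_presheaf_product is_presheaf_terminal is_presheaf_ClockPred)
  have var: "var_clock = (\<lambda>U. snd)" by (simp add: var_clock_def fun_eq_iff)
  have step: "kj_all CLK Ctx_pred Clock pred_app U \<alpha>"
    if "\<alpha> \<in> El Ctx_pred U"
      "kj_all CLK Ctx_pred Clock (later Ctx_pred_clock var_clock pred_app) U \<alpha>" for U \<alpha>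
    using kj_all_if_kj_all_later[OF X subobject_pred_app[unfolded Ctx_pred_clock_def] that(1)] that(2)
    by (simp add: Ctx_pred_clock_def var)
  show ?thesis
    unfolding holds_internally_def
  proof
    fix U assume "U \<in> Ob CLK"
    show "kj_all CLK terminal ClockPred
       (kj_imp CLK Ctx_pred
         (kj_all CLK Ctx_pred Clock (later Ctx_pred_clock var_clock pred_app))
         (kj_all CLK Ctx_pred Clock pred_app)) U ()"
      \<comment> \<open>Only the outermost quantifier is unfolded; the two over clocks stay folded
        to match \<open>step\<close>.\<close>
      unfolding kj_all_def[of CLK terminal] kj_imp_def
    proof (intro ballI impI)
      fix f g and \<phi> :: clk_pred
      let ?\<alpha> = "(res (terminal :: (clk_obj, clk_arrow, unit) presheaf) f (), \<phi>)"
      assume "\<phi> \<in> El ClockPred (Dom CLK f)" and g: "g \<in> arrows_to CLK (Dom CLK f)"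
        and hyp: "kj_all CLK Ctx_pred Clock (later Ctx_pred_clock var_clock pred_app)
          (Dom CLK g) (res Ctx_pred g ?\<alpha>)"
      then have "?\<alpha> \<in> El Ctx_pred (Cod CLK g)"
        by (simp add: Ctx_pred_def product_def terminal_def arrows_to_def)
      then have "res Ctx_pred g ?\<alpha> \<in> El Ctx_pred (Dom CLK g)"
        using X g by (simp add: is_presheaf_def arrows_to_def)
      then show "kj_all CLK Ctx_pred Clock pred_app
          (Dom CLK g) (res Ctx_pred g ?\<alpha>)"
        using hyp by (rule step)
    qed
  qed
qed

end
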